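(* Let $A$ be a Banach algebra (not necessarily commutative) and let $B$ be a semisimple commutative Banach algebra. Let $h: A\to B$ be a 3-Jordan homomorphism, i.e. an additive map (not assumed linear or continuous) with $h(a^3)=(h(a))^3$ for all $a\in A$. Then $h$ is a 3-ring homomorphism, i.e. $h(abc)=h(a)h(b)h(c)$ for all $a,b,c\in A$.
   Context: Banach algebras are over $\mathbb{C}$ and are not assumed to be unital. Additive means $h(a+b)=h(a)+h(b)$ for all $a,b\in A$. A commutative Banach algebra $B$ is semisimple if the intersection of the kernels of all its characters (nonzero multiplicative linear functionals $B\to\mathbb{C}$) is $\{0\}$. *)

theory Defs
  imports "HOL-Analysis.Analysis"
begin

text \<open>
  Complex Banach algebras, not assumed unital or commutative. The library's
  \<open>real_normed_algebra\<close> is a non-unital ring with a submultiplicative norm that is an algebra over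
  the reals, and \<open>banach\<close> adds completeness; the class below adds a complex
  scalar multiplication extending the real one.
\<close>

class complex_banach_algebra = real_normed_algebra + banach +
  fixes scaleC :: "complex \<Rightarrow> 'a \<Rightarrow> 'a"
  assumes scaleC_add_right: "scaleC c (x + y) = scaleC c x + scaleC c y"
    and scaleC_add_left: "scaleC (c + d) x = scaleC c x + scaleC d x"
    and scaleC_scaleC: "scaleC c (scaleC d x) = scaleC (c * d) x"
    and scaleC_of_real: "scaleC (complex_of_real r) x = scaleR r x"
    and mult_scaleC_left: "scaleC c x * y = scaleC c (x * y)"
    and mult_scaleC_right: "x * scaleC c y = scaleC c (x * y)"
    and norm_scaleC: "norm (scaleC c x) = cmod c * norm x"

definition is_character :: "('b::complex_banach_algebra \<Rightarrow> complex) \<Rightarrow> bool" where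
  "is_character \<phi> \<longleftrightarrow>
     (\<forall>x y. \<phi> (x + y) = \<phi> x + \<phi> y) \<and>
     (\<forall>c x. \<phi> (scaleC c x) = c * \<phi> x) \<and>
     (\<forall>x y. \<phi> (x * y) = \<phi> x * \<phi> y) \<and>
     (\<exists>x. \<phi> x \<noteq> 0)"

text \<open>
  If there are no characters, the intersection is the whole algebra, so only the zero algebra is
  then semisimple.
\<close>

definition semisimple :: "'b::{complex_banach_algebra, comm_ring} itself \<Rightarrow> bool" where
  "semisimple _ \<longleftrightarrow> (\<Inter>\<phi>\<in>{\<phi>. is_character \<phi>}. {x::'b. \<phi> x = 0}) = {0}"

text \<open>
  Cubes are written as products because the power operation of the library requires a unit.
\<close>

definition three_jordan_hom ::
  "('a::complex_banach_algebra \<Rightarrow> 'b::complex_banach_algebra) \<Rightarrow> bool" where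
  "three_jordan_hom h \<longleftrightarrow>
     (\<forall>a b. h (a + b) = h a + h b) \<and> (\<forall>a. h (a * a * a) = h a * h a * h a)"

definition three_ring_hom ::
  "('a::complex_banach_algebra \<Rightarrow> 'b::complex_banach_algebra) \<Rightarrow> bool" where
  "three_ring_hom h \<longleftrightarrow>
     (\<forall>a b. h (a + b) = h a + h b) \<and> (\<forall>a b c. h (a * b * c) = h a * h b * h c)"

end

theory Submission
  imports Defs
begin

text \<open>
  Composing \<open>h\<close> with a character of \<open>B\<close> gives an additive \<open>f : A \<rightarrow> \<complex>\<close> with \<open>f (x\<^sup>3) = (f x)\<^sup>3\<close>, and
  semisimplicity says that it is enough to treat these \<open>f\<close>. From here on the argument is purely
  algebraic: it works for every ring \<open>A\<close> and every field of characteristic zero.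

  The point is that cubes already control squares up to a sign. Polarising the cube identity gives
  \<open>f (a * b * c) = f a * f b * f c\<close> for powers \<open>a\<close>, \<open>b\<close>, \<open>c\<close> of a single element \<open>x\<close>. Factoring
  \<open>x\<^sup>5\<close> and \<open>x\<^sup>6\<close> in two ways each then forces \<open>(f (x\<^sup>2))\<^sup>2 = (f x)\<^sup>4\<close>
  (\<open>cube_hom_square_square\<close>), that is, \<open>f (x\<^sup>2) = \<plusminus>(f x)\<^sup>2\<close>. Both \<open>f (x\<^sup>2)\<close> and \<open>(f x)\<^sup>2\<close> are
  quadratic in \<open>x\<close>, so a comparison along the lines \<open>x + t e\<close> shows that the sign is the same for
  all \<open>x\<close> (\<open>cube_hom_sign\<close>). Hence \<open>f\<close> or \<open>-f\<close> preserves squares. A square-preserving additive map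
  into a field is multiplicative (\<open>jordan_hom_into_field_mult\<close>, the classical argument of
  Zelazko), and from \<open>-f (a * b * c) = (-f a) * (-f b) * (-f c)\<close> the same conclusion for \<open>f\<close>
  follows in the second case too, three being odd.
\<close>

text \<open>
  Polarisation of \<open>f (x\<^sup>2) = (f x)\<^sup>2\<close> determines \<open>f (x * y) + f (y * x)\<close> and \<open>f (y * x * y)\<close>. Since
  \<open>(x * y)\<^sup>2 + (y * x)\<^sup>2\<close> is the Jordan product of \<open>x\<close> and \<open>y * x * y\<close>, the sum of the squares of
  \<open>f (x * y)\<close> and \<open>f (y * x)\<close> is determined as well, and it leaves no room for a difference
  between the two.
\<close>

lemma jordan_hom_into_field_mult:
  fixes f :: "'a::ring \<Rightarrow> 'k::field_char_0"
  assumes add: "\<And>x y. f (x + y) = f x + f y"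
    and sq: "\<And>x. f (x * x) = f x * f x"
  shows "f (x * y) = f x * f y"
proof -
  have jordan: "f (a * b) + f (b * a) = 2 * f a * f b" for a b
    using sq[of "a + b"] by (simp add: add sq algebra_simps)
  have "2 * f (y * x * y) + (f (x * (y * y)) + f ((y * y) * x))
      = (f ((x * y) * y) + f (y * (x * y))) + (f ((y * x) * y) + f (y * (y * x)))"
    by (simp add: mult.assoc)
  also have "\<dots> = 2 * f y * (f (x * y) + f (y * x))"
    unfolding jordan[of "x * y" y] jordan[of "y * x" y] by (simp only: algebra_simps)
  also have "\<dots> = 4 * f x * f y * f y"
    unfolding jordan[of x y] by (simp add: algebra_simps)
  finally have "2 * f (y * x * y) = 2 * (f x * f y * f y)"
    unfolding jordan[of x "y * y"] sq by (simp add: algebra_simps)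
  then have yxy: "f (y * x * y) = f x * f y * f y"
    by simp
  have "f (x * y) * f (x * y) + f (y * x) * f (y * x)
      = f (x * (y * x * y)) + f ((y * x * y) * x)"
    by (simp add: sq[symmetric] mult.assoc)
  also have "\<dots> = 2 * (f x * f y) * (f x * f y)"
    by (simp add: jordan yxy)
  finally have squares: "f (x * y) * f (x * y) + f (y * x) * f (y * x)
      = 2 * (f x * f y) * (f x * f y)" .
  have yx: "f (y * x) = 2 * (f x * f y) - f (x * y)"
    using jordan[of x y] by (simp add: algebra_simps)
  have "2 * (f (x * y) - f x * f y)\<^sup>2 = 0"
    using squares unfolding yx by (simp add: algebra_simps power2_eq_square)
  then show ?thesis by simp
qed

lemma cube_hom_polarised:
  fixes f :: "'a::ring \<Rightarrow> 'k::field_char_0"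
  assumes add: "\<And>x y. f (x + y) = f x + f y"
    and cube: "\<And>x. f (x * x * x) = f x * f x * f x"
  shows "f (a*b*c) + f (a*c*b) + f (b*a*c) + f (b*c*a) + f (c*a*b) + f (c*b*a) = 6 * f a * f b * f c"
proof -
  have "a*b*c + a*c*b + b*a*c + b*c*a + c*a*b + c*b*a
      + (a+b)*(a+b)*(a+b) + (b+c)*(b+c)*(b+c) + (a+c)*(a+c)*(a+c)
      = (a+b+c)*(a+b+c)*(a+b+c) + a*a*a + b*b*b + c*c*c"
    by (simp add: algebra_simps)
  then have "f (a*b*c + a*c*b + b*a*c + b*c*a + c*a*b + c*b*a
      + (a+b)*(a+b)*(a+b) + (b+c)*(b+c)*(b+c) + (a+c)*(a+c)*(a+c))
      = f ((a+b+c)*(a+b+c)*(a+b+c) + a*a*a + b*b*b + c*c*c)"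
    by (rule arg_cong)
  then show ?thesis
    unfolding add cube by (simp add: algebra_simps)
qed

text \<open>
  With \<open>\<alpha> = f x\<close> and \<open>q = f (x\<^sup>2)\<close>, the factorisations \<open>x\<^sup>5 = x * x\<^sup>2 * x\<^sup>2 = x * x * x\<^sup>3\<close> give
  \<open>\<alpha> q\<^sup>2 = \<alpha>\<^sup>5\<close>, which settles \<open>\<alpha> \<noteq> 0\<close>. For \<open>\<alpha> = 0\<close> the factorisations
  \<open>x\<^sup>6 = (x\<^sup>2)\<^sup>3 = x * x\<^sup>2 * x\<^sup>3\<close> give \<open>q\<^sup>3 = 0\<close>.
\<close>

lemma cube_hom_square_square:
  fixes f :: "'a::ring \<Rightarrow> 'k::field_char_0"
  assumes add: "\<And>x y. f (x + y) = f x + f y"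
    and cube: "\<And>x. f (x * x * x) = f x * f x * f x"
  shows "(f (x * x))\<^sup>2 = (f x) ^ 4"
proof (cases "f x = 0")
  case True
  have "6 * f (x*x*x*x*x*x) = 0"
    using cube_hom_polarised[where f = f, OF add cube, of x "x*x" "x*x*x"] True by (simp add: mult.assoc)
  moreover have "f (x*x*x*x*x*x) = f (x*x) * f (x*x) * f (x*x)"
    using cube[of "x*x"] by (simp add: mult.assoc)
  ultimately show ?thesis
    using True by simp
next
  case False
  have "6 * f (x*x*x*x*x) = 6 * f x * f (x*x) * f (x*x)"
    using cube_hom_polarised[where f = f, OF add cube, of x "x*x" "x*x"] by (simp add: mult.assoc)
  moreover have "6 * f (x*x*x*x*x) = 6 * f x * f x * f (x*x*x)"
    using cube_hom_polarised[where f = f, OF add cube, of x x "x*x*x"] by (simp add: mult.assoc)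
  ultimately have "6 * f x * f (x*x) * f (x*x) = 6 * f x * f x * (f x * f x * f x)"
    by (simp only: cube)
  then have "f x * (f (x*x))\<^sup>2 = f x * (f x) ^ 4"
    by (simp add: power2_eq_square power4_eq_xxxx mult.assoc)
  with False show ?thesis by simp
qed

text \<open>
  Fix \<open>e\<close> with \<open>f e \<noteq> 0\<close>; it determines the sign. Along the line \<open>x + t e\<close> the identity
  \<open>(f (z\<^sup>2))\<^sup>2 = (f z)\<^sup>4\<close> is an equality of polynomials in the integer \<open>t\<close>. Comparing the
  coefficients of \<open>t\<^sup>3\<close> and \<open>t\<^sup>2\<close> transfers the sign from \<open>e\<close> first to the mixed term
  \<open>f (x * e + e * x)\<close> and then to \<open>f (x\<^sup>2)\<close>.
\<close>

lemma cube_hom_sign: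
  fixes f :: "'a::ring \<Rightarrow> 'k::field_char_0"
  assumes add: "\<And>x y. f (x + y) = f x + f y"
    and cube: "\<And>x. f (x * x * x) = f x * f x * f x"
  obtains s :: 'k where "s * s = 1" and "\<And>x. f (x * x) = s * (f x * f x)"
proof (cases "\<exists>e. f e \<noteq> 0")
  case False
  then show ?thesis using that[of 1] by simp
next
  case True
  then obtain e where e: "f e \<noteq> 0" by blast
  note sqsq = cube_hom_square_square[where f = f, OF add cube]
  define \<beta> where "\<beta> = f e"
  define s where "s = f (e * e) / \<beta>\<^sup>2"
  have \<beta>: "\<beta> \<noteq> 0" using e by (simp add: \<beta>_def)
  have p: "f (e * e) = s * \<beta>\<^sup>2" using \<beta> by (simp add: s_def)
  have ss: "s * s = 1"
    using sqsq[of e] \<beta> by (simp add: s_def \<beta>_def power2_eq_square power4_eq_xxxx)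
  have minus: "f (- y) = - f y" for y
    using add[of y "- y"] add[of 0 0] by (simp add: eq_neg_iff_add_eq_0 add.commute)
  have "f (x * x) = s * (f x * f x)" for x
  proof -
    define \<alpha> where "\<alpha> = f x"
    define q where "q = f (x * x)"
    define B where "B = f (x * e) + f (e * x)"
    define d1 where "d1 = 2 * q * B - 4 * \<alpha>^3 * \<beta>"
    define d2 where "d2 = B\<^sup>2 + 2 * q * (s * \<beta>\<^sup>2) - 6 * \<alpha>\<^sup>2 * \<beta>\<^sup>2"
    define d3 where "d3 = 2 * B * (s * \<beta>\<^sup>2) - 4 * \<alpha> * \<beta>^3"
    have q2: "q\<^sup>2 = \<alpha>^4" unfolding q_def \<alpha>_def by (rule sqsq)
    have p2: "(s * \<beta>\<^sup>2)\<^sup>2 = \<beta>^4"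
      using sqsq[of e] by (simp add: p \<beta>_def)
    have line: "t * d1 + t\<^sup>2 * d2 + t^3 * d3 = 0"
      if "(q + t * B + t\<^sup>2 * (s * \<beta>\<^sup>2))\<^sup>2 = (\<alpha> + t * \<beta>)^4" for t
    proof -
      have "t * d1 + t\<^sup>2 * d2 + t^3 * d3
          = ((q + t * B + t\<^sup>2 * (s * \<beta>\<^sup>2))\<^sup>2 - (\<alpha> + t * \<beta>)^4)
            - (q\<^sup>2 - \<alpha>^4) - t^4 * ((s * \<beta>\<^sup>2)\<^sup>2 - \<beta>^4)"
        unfolding d1_def d2_def d3_def by algebra
      then show ?thesis using that q2 p2 by simp
    qed
    \<comment> \<open>By \<open>q2\<close> and \<open>p2\<close> the coefficients of \<open>t\<^sup>0\<close> and \<open>t\<^sup>4\<close> cancel, so the three values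
        \<open>1\<close>, \<open>-1\<close>, \<open>2\<close> of \<open>t\<close> separate the remaining coefficients.\<close>
    have "1 * d1 + 1\<^sup>2 * d2 + 1^3 * d3 = 0"
    proof (rule line)
      have "f ((x + e) * (x + e)) = q + 1 * B + 1\<^sup>2 * (s * \<beta>\<^sup>2)"
        by (simp add: distrib_left distrib_right add p q_def B_def)
      moreover have "f (x + e) = \<alpha> + 1 * \<beta>"
        by (simp add: add \<alpha>_def \<beta>_def)
      ultimately show "(q + 1 * B + 1\<^sup>2 * (s * \<beta>\<^sup>2))\<^sup>2 = (\<alpha> + 1 * \<beta>)^4"
        using sqsq[of "x + e"] by simp
    qed
    moreover have "(-1) * d1 + (-1)\<^sup>2 * d2 + (-1)^3 * d3 = 0"
    proof (rule line)
      have "(x + - e) * (x + - e) = x * x + - (x * e) + - (e * x) + e * e"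
        by (simp add: algebra_simps)
      then have "f ((x + - e) * (x + - e)) = q + (-1) * B + (-1)\<^sup>2 * (s * \<beta>\<^sup>2)"
        by (simp only: add minus p q_def B_def) simp
      moreover have "f (x + - e) = \<alpha> + (-1) * \<beta>"
        by (simp only: add minus \<alpha>_def \<beta>_def) simp
      ultimately show "(q + (-1) * B + (-1)\<^sup>2 * (s * \<beta>\<^sup>2))\<^sup>2 = (\<alpha> + (-1) * \<beta>)^4"
        using sqsq[of "x + - e"] by (simp only:)
    qed
    moreover have "2 * d1 + 2\<^sup>2 * d2 + 2^3 * d3 = 0"
    proof (rule line)
      have "f ((x + (e + e)) * (x + (e + e))) = q + 2 * B + 2\<^sup>2 * (s * \<beta>\<^sup>2)"
        by (simp add: distrib_left distrib_right add p q_def B_def)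
      moreover have "f (x + (e + e)) = \<alpha> + 2 * \<beta>"
        by (simp add: add \<alpha>_def \<beta>_def)
      ultimately show "(q + 2 * B + 2\<^sup>2 * (s * \<beta>\<^sup>2))\<^sup>2 = (\<alpha> + 2 * \<beta>)^4"
        using sqsq[of "x + (e + e)"] by (simp only:)
    qed
    ultimately have A: "d1 + d2 + d3 = 0" "- d1 + d2 - d3 = 0" "2 * d1 + 4 * d2 + 8 * d3 = 0"
      by simp_all
    have "2 * d2 = 0" using A(1,2) by algebra
    then have d2: "d2 = 0" by simp
    have "6 * d3 = 0" using A(1,3) d2 by algebra
    then have d3: "d3 = 0" by simp
    have "2 * \<beta>\<^sup>2 * (B - 2 * s * \<alpha> * \<beta>) = 0"
      using d3 ss unfolding d3_def by algebra
    then have B: "B = 2 * s * \<alpha> * \<beta>" using \<beta> by simp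
    have "2 * \<beta>\<^sup>2 * (q - s * (\<alpha> * \<alpha>)) = 0"
      using d2 ss unfolding d2_def B by algebra
    then have "q = s * (\<alpha> * \<alpha>)" using \<beta> by simp
    then show ?thesis by (simp add: q_def \<alpha>_def)
  qed
  with ss show ?thesis by (rule that)
qed

lemma cube_hom_into_field_mult3:
  fixes f :: "'a::ring \<Rightarrow> 'k::field_char_0"
  assumes add: "\<And>x y. f (x + y) = f x + f y"
    and cube: "\<And>x. f (x * x * x) = f x * f x * f x"
  shows "f (a * b * c) = f a * f b * f c"
proof -
  obtain s where s: "s * s = 1" and sq: "\<And>x. f (x * x) = s * (f x * f x)"
    using cube_hom_sign[where f = f, OF add cube] by blast
  have "s * f (x * y) = (s * f x) * (s * f y)" for x y
    by (rule jordan_hom_into_field_mult[where f = "\<lambda>z. s * f z"])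
      (simp_all add: add sq algebra_simps)
  then have sm: "s * f (x * y) = s * (s * (f x * f y))" for x y
    by (simp add: ac_simps)
  have mult: "f (x * y) = s * (f x * f y)" for x y
    using sm[of x y] s by auto
  have "f (a * b * c) = (s * s) * (f a * f b * f c)"
    by (simp add: mult ac_simps)
  then show ?thesis by (simp add: s)
qed

theorem theorem2p5:
  fixes h :: "'a::complex_banach_algebra \<Rightarrow> 'b::{complex_banach_algebra, comm_ring}"
  assumes "semisimple TYPE('b)"
    and "three_jordan_hom h"
  shows "three_ring_hom h"
proof -
  have add: "h (a + b) = h a + h b" and cube: "h (a * a * a) = h a * h a * h a" for a b
    using assms(2) by (auto simp: three_jordan_hom_def)
  have "h (a * b * c) = h a * h b * h c" for a b c
  proof -
    have "\<phi> (h (a * b * c) - h a * h b * h c) = 0" if "is_character \<phi>" for \<phi> :: "'b \<Rightarrow> complex"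
    proof -
      have \<phi>_add: "\<phi> (x + y) = \<phi> x + \<phi> y" and \<phi>_mult: "\<phi> (x * y) = \<phi> x * \<phi> y" for x y
        using that by (auto simp: is_character_def)
      have "\<phi> (h (a * b * c)) = \<phi> (h a) * \<phi> (h b) * \<phi> (h c)"
        by (rule cube_hom_into_field_mult3[where f = "\<lambda>z. \<phi> (h z)"])
          (simp_all add: add cube \<phi>_add \<phi>_mult)
      moreover have "\<phi> (x - y) = \<phi> x - \<phi> y" for x y
        using \<phi>_add[of "x - y" y] by simp
      ultimately show ?thesis by (simp add: \<phi>_mult)
    qed
    then have "h (a * b * c) - h a * h b * h c \<in> (\<Inter>\<phi>\<in>{\<phi>. is_character \<phi>}. {x. \<phi> x = 0})"
      by blast
    then have "h (a * b * c) - h a * h b * h c \<in> {0}"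
      using assms(1) by (simp only: semisimple_def)
    then show ?thesis by simp
  qed
  with add show ?thesis by (simp add: three_ring_hom_def)
qed

end
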